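(* The multi-machine Windows Scheduling Problem with unit-size jobs having exact periods and no machine migration allowed can be reduced to the single-machine variant of that problem (unit-size jobs, exact periods) in polynomial time.
   Context: Windows Scheduling Problem: given jobs $j=1,\ldots,n$ with integer periods $p_1,\ldots,p_n$ (and here unit processing length), decide whether there is an infinite non-preemptive schedule in which every job is executed infinitely often. With exact periods, the time between any two consecutive executions (start times) of job $j$ must be exactly $p_j$. In the multi-machine variant there are $m$ machines, each processing at most one job per time slot; with no machine migration, each job must be assigned to a fixed machine on which all its executions take place. The single-machine variant is the case $m=1$. *)

theory Defs
  imports Main "HOL-Computational_Algebra.Polynomial"
begin

section \<open>Deterministic multi-tape Turing machines\<close>

datatype move = MoveLeft | Stay | MoveRight

text \<open>A tape is infinite in both directions; it consists of its contents (\<open>None\<close> is the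
  blank symbol) and the head position.\<close>

type_synonym 'a tape = "(int \<Rightarrow> 'a option) \<times> int"

record 'a tm =
  num_tapes :: nat
  num_states :: nat
  start :: nat
  halt :: nat
  trans :: "nat \<Rightarrow> 'a option list \<Rightarrow> nat \<times> ('a option \<times> move) list"

text \<open>Together with the sort \<open>finite\<close> of the alphabet, this makes the relevant part of \<open>trans\<close>
  a finite table: only its values for states below \<open>num_states\<close> and for symbol lists of length
  \<open>num_tapes\<close> are ever used.\<close>

definition wf_tm :: "('a::finite) tm \<Rightarrow> bool" where
  "wf_tm M \<longleftrightarrow>
     num_tapes M \<ge> 1 \<and> start M < num_states M \<and> halt M < num_states M \<and>
     (\<forall>q < num_states M. \<forall>syms. length syms = num_tapes M \<longrightarrow>
        fst (trans M q syms) < num_states M \<and> length (snd (trans M q syms)) = num_tapes M)"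

fun read_tape :: "'a tape \<Rightarrow> 'a option" where
  "read_tape (c, h) = c h"

fun act_tape :: "'a option \<times> move \<Rightarrow> 'a tape \<Rightarrow> 'a tape" where
  "act_tape (s, d) (c, h) =
     (c(h := s), case d of MoveLeft \<Rightarrow> h - 1 | Stay \<Rightarrow> h | MoveRight \<Rightarrow> h + 1)"

fun step :: "'a tm \<Rightarrow> nat \<times> 'a tape list \<Rightarrow> nat \<times> 'a tape list" where
  "step M (q, tps) =
     (if q = halt M then (q, tps)
      else let (q', acts) = trans M q (map read_tape tps) in (q', map2 act_tape acts tps))"

definition word_on_tape :: "'a list \<Rightarrow> int \<Rightarrow> 'a option" where
  "word_on_tape w i = (if 0 \<le> i \<and> i < int (length w) then Some (w ! nat i) else None)"

text \<open>The input is on the first tape, the output is expected on the last tape (which contains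
  nothing else).\<close>

definition initial_config :: "'a tm \<Rightarrow> 'a list \<Rightarrow> nat \<times> 'a tape list" where
  "initial_config M w =
     (start M, (word_on_tape w, 0) # replicate (num_tapes M - 1) (\<lambda>_. None, 0))"

definition computes_in_time :: "('a::finite) tm \<Rightarrow> ('a list \<Rightarrow> 'a list) \<Rightarrow> (nat \<Rightarrow> nat) \<Rightarrow> bool" where
  "computes_in_time M f T \<longleftrightarrow>
     (\<forall>w. case (step M ^^ T (length w)) (initial_config M w) of
            (q, tps) \<Rightarrow> q = halt M \<and> fst (last tps) = word_on_tape (f w))"

definition poly_time_computable :: "(('a::finite) list \<Rightarrow> 'a list) \<Rightarrow> bool" where
  "poly_time_computable f \<longleftrightarrow>
     (\<exists>M (p :: nat poly). wf_tm M \<and> computes_in_time M f (poly p))"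

definition poly_time_reducible :: "('a::finite) list set \<Rightarrow> 'a list set \<Rightarrow> bool"
    (infix "\<le>\<^sub>p" 50) where
  "A \<le>\<^sub>p B \<longleftrightarrow> (\<exists>f. poly_time_computable f \<and> (\<forall>w. w \<in> A \<longleftrightarrow> f w \<in> B))"


section \<open>Windows scheduling with unit jobs and exact periods\<close>

text \<open>\<open>S i t = Some j\<close> means that machine \<open>i\<close> executes job \<open>j\<close> in time slot \<open>t\<close>;
  jobs and machines are numbered from 0, and \<open>ps ! j\<close> is the period of job \<open>j\<close>.\<close>

type_synonym schedule = "nat \<Rightarrow> nat \<Rightarrow> nat option"

definition executions :: "schedule \<Rightarrow> nat \<Rightarrow> nat \<Rightarrow> nat set" where
  "executions S i j = {t. S i t = Some j}"

definition consecutive :: "nat set \<Rightarrow> nat \<Rightarrow> nat \<Rightarrow> bool" where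
  "consecutive E t t' \<longleftrightarrow> t \<in> E \<and> t' \<in> E \<and> t < t' \<and> (\<forall>s. t < s \<and> s < t' \<longrightarrow> s \<notin> E)"

definition exact_schedule :: "nat \<Rightarrow> nat list \<Rightarrow> schedule \<Rightarrow> bool" where
  "exact_schedule m ps S \<longleftrightarrow>
     (\<forall>j < length ps. \<exists>i < m.
        (\<forall>i' < m. i' \<noteq> i \<longrightarrow> executions S i' j = {}) \<and>
        infinite (executions S i j) \<and>
        (\<forall>t t'. consecutive (executions S i j) t t' \<longrightarrow> t' - t = ps ! j))"

definition schedulable :: "nat \<Rightarrow> nat list \<Rightarrow> bool" where
  "schedulable m ps \<longleftrightarrow> (\<exists>S. exact_schedule m ps S)"


section \<open>The decision problems as formal languages\<close>

datatype letter = Zero | One | Sep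

instance letter :: finite
proof
  have "(UNIV :: letter set) = {Zero, One, Sep}"
    using letter.exhaust by auto
  then show "finite (UNIV :: letter set)"
    by (metis finite.emptyI finite_insert)
qed

text \<open>Binary representation, most significant digit first, without leading zeros.\<close>

fun binary :: "nat \<Rightarrow> letter list" where
  "binary n = (if n = 0 then [] else binary (n div 2) @ [if even n then Zero else One])"

declare binary.simps [simp del]

definition encode :: "nat list \<Rightarrow> letter list" where
  "encode ns = concat (map (\<lambda>n. binary n @ [Sep]) ns)"

definition WSP_multi :: "letter list set" where
  "WSP_multi = {encode (m # ps) | m ps. m \<ge> 1 \<and> (\<forall>p \<in> set ps. p \<ge> 1) \<and> schedulable m ps}"

definition WSP_single :: "letter list set" where
  "WSP_single = {encode ps | ps. (\<forall>p \<in> set ps. p \<ge> 1) \<and> schedulable 1 ps}"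

lemma binary_inject: "binary a = binary b \<Longrightarrow> a = b"
proof (induction a arbitrary: b rule: less_induct)
  case (less a)
  show ?case
  proof (cases "a = 0 \<or> b = 0")
    case True
    then show ?thesis
      using less.prems by (auto simp: binary.simps[of a] binary.simps[of b] split: if_splits)
  next
    case False
    then have "binary (a div 2) = binary (b div 2)" and par: "even a \<longleftrightarrow> even b"
      using less.prems by (auto simp: binary.simps[of a] binary.simps[of b] split: if_splits)
    then have "a div 2 = b div 2"
      using less.IH[of "a div 2"] False by simp
    with par show ?thesis
      by (metis dvd_mult_div_cancel odd_two_times_div_two_succ)
  qed
qed

lemma Sep_notin_binary: "Sep \<notin> set (binary n)"
  by (induction n rule: less_induct) (subst binary.simps, auto)

lemma append_Sep_cancel:
  "xs @ Sep # us = ys @ Sep # vs \<Longrightarrow> Sep \<notin> set xs \<Longrightarrow> Sep \<notin> set ys \<Longrightarrow> xs = ys \<and> us = vs"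
  by (induction xs arbitrary: ys) (case_tac ys; auto)+

lemma inj_encode: "inj encode"
proof
  show "xs = ys" if "encode xs = encode ys" for xs ys
    using that
  proof (induction xs arbitrary: ys)
    case Nil
    then show ?case by (cases ys) (auto simp: encode_def)
  next
    case (Cons x xs)
    then obtain y ys' where ys: "ys = y # ys'"
      by (cases ys) (auto simp: encode_def)
    with Cons.prems have "binary x @ Sep # encode xs = binary y @ Sep # encode ys'"
      by (simp add: encode_def)
    then have "binary x = binary y" "encode xs = encode ys'"
      using append_Sep_cancel Sep_notin_binary by blast+
    with Cons.IH ys show ?case
      using binary_inject by blast
  qed
qed

end

theory Submission
  imports Defs
begin

text \<open>Splitting the slots of each machine by parity shows that \<open>2 * v\<close> machines can run the periods
  \<open>ps\<close> iff \<open>v\<close> machines can run the doubled periods. An odd number of machines is first made even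
  by adding one machine together with a job of period 1 that fills it. Iterating this along the
  binary digits of \<open>m\<close>, down to a single machine, multiplies every period by \<open>2 ^ k\<close>, where \<open>k\<close> is
  the number of digits of \<open>m\<close>, and produces at most \<open>k + 1\<close> filler jobs whose periods are powers
  of two. In binary, multiplication by \<open>2 ^ k\<close> appends \<open>k\<close> zeros, so a Turing machine only has to
  copy its input and to keep a unary counter, in quadratic time.\<close>

section \<open>Schedules as residue classes\<close>

text \<open>Job \<open>j\<close> occupies the residue class of \<open>a j\<close> on machine \<open>\<mu> j\<close>. Two classes that meet do so
  arbitrarily late, so it does not matter in which slot the executions of a job begin.\<close>

definition assignment :: "nat \<Rightarrow> nat list \<Rightarrow> (nat \<Rightarrow> nat) \<Rightarrow> (nat \<Rightarrow> nat) \<Rightarrow> bool" where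
  "assignment m ps \<mu> a \<longleftrightarrow>
     (\<forall>j < length ps. \<mu> j < m) \<and>
     (\<forall>i < length ps. \<forall>j < length ps. \<forall>x. \<mu> i = \<mu> j \<longrightarrow> x mod ps ! i = a i mod ps ! i \<longrightarrow>
        x mod ps ! j = a j mod ps ! j \<longrightarrow> i = j)"

lemma assignmentD:
  assumes "assignment m ps \<mu> a" "i < length ps" "j < length ps" "\<mu> i = \<mu> j"
    "x mod ps ! i = a i mod ps ! i" "x mod ps ! j = a j mod ps ! j"
  shows "i = j"
  using assms unfolding assignment_def by blast

text \<open>In an infinite set every element has a least later one. A constant gap therefore carries
  any chosen element upwards in steps of \<open>p\<close>.\<close>

lemma exact_gaps_progression:
  assumes inf: "infinite E" and gap: "\<And>t t'. consecutive E t t' \<Longrightarrow> t' - t = p"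
  shows "\<exists>a. \<forall>k. a + k * p \<in> E"
proof -
  have nxt: "t + p \<in> E" if "t \<in> E" for t
  proof -
    define t' where "t' = (LEAST s. s \<in> E \<and> t < s)"
    have ex: "\<exists>s. s \<in> E \<and> t < s"
      using inf by (meson infinite_nat_iff_unbounded)
    have t': "t' \<in> E" "t < t'"
      using LeastI_ex[OF ex] unfolding t'_def by auto
    have "s \<notin> E" if "t < s" "s < t'" for s
      using that not_less_Least[of s "\<lambda>s. s \<in> E \<and> t < s"] unfolding t'_def by auto
    then have "consecutive E t t'"
      using t' \<open>t \<in> E\<close> unfolding consecutive_def by blast
    then have "t' = t + p"
      using gap t' by fastforce
    with t' show ?thesis by simp
  qed
  obtain a where "a \<in> E"
    using inf by (metis finite.emptyI all_not_in_conv)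
  have "a + k * p \<in> E" for k
  proof (induction k)
    case (Suc k)
    from nxt[OF this] show ?case
      by (simp add: algebra_simps)
  qed (use \<open>a \<in> E\<close> in simp)
  then show ?thesis by blast
qed

lemma consecutive_residue_class:
  assumes "consecutive {t. t mod p = a mod p} t t'" "p \<ge> 1"
  shows "t' - t = p"
proof -
  have t: "t mod p = a mod p" "t' mod p = a mod p" "t < t'"
    and no: "\<And>s. t < s \<Longrightarrow> s < t' \<Longrightarrow> s mod p \<noteq> a mod p"
    using assms(1) unfolding consecutive_def by auto
  have "p dvd t' - t"
    using t by (metis less_imp_le mod_eq_dvd_iff_nat)
  then have "p \<le> t' - t"
    using t by (simp add: dvd_imp_le)
  moreover have "\<not> t + p < t'"
    using no[of "t + p"] t assms(2) by auto
  ultimately show ?thesis by simp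
qed

lemma infinite_residue_class:
  assumes "p \<ge> (1::nat)"
  shows "infinite {t. t mod p = a mod p}"
proof -
  have "\<exists>t>n. t mod p = a mod p" for n
  proof (intro exI conjI)
    have "n < Suc n * 1" by simp
    also have "\<dots> \<le> Suc n * p"
      using assms by (intro mult_le_mono) auto
    also have "\<dots> \<le> a + Suc n * p"
      by (rule le_add2)
    finally show "n < a + Suc n * p" .
    show "(a + Suc n * p) mod p = a mod p"
      by (rule mod_mult_self1)
  qed
  then show ?thesis
    by (auto simp: infinite_nat_iff_unbounded)
qed

text \<open>Forwards, each job runs on an arithmetic progression inside its residue class, and a
  collision of two classes can be moved late enough to hit both progressions. Backwards, since
  classes on one machine are disjoint, the machine can run in each slot the one job whose class
  contains it.\<close>

lemma schedulable_iff_assignment: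
  assumes pos: "\<forall>p \<in> set ps. p \<ge> 1"
  shows "schedulable m ps \<longleftrightarrow> (\<exists>\<mu> a. assignment m ps \<mu> a)"
proof
  assume "schedulable m ps"
  then obtain S where S: "exact_schedule m ps S"
    unfolding schedulable_def by blast
  have "\<forall>j. \<exists>i a. j < length ps \<longrightarrow> i < m \<and> (\<forall>k. S i (a + k * ps ! j) = Some j)"
  proof (intro allI)
    fix j
    show "\<exists>i a. j < length ps \<longrightarrow> i < m \<and> (\<forall>k. S i (a + k * ps ! j) = Some j)"
    proof (cases "j < length ps")
      case True
      then obtain i where i: "i < m" "infinite (executions S i j)"
        "\<And>t t'. consecutive (executions S i j) t t' \<Longrightarrow> t' - t = ps ! j"
        using S unfolding exact_schedule_def by blast
      then obtain a where "\<forall>k. a + k * ps ! j \<in> executions S i j"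
        using exact_gaps_progression by metis
      with i show ?thesis
        unfolding executions_def by blast
    qed auto
  qed
  then obtain \<mu> a where
    \<mu>: "\<And>j. j < length ps \<Longrightarrow> \<mu> j < m" and
    run: "\<And>j k. j < length ps \<Longrightarrow> S (\<mu> j) (a j + k * ps ! j) = Some j"
    by metis
  have "i = j" if ij: "i < length ps" "j < length ps" "\<mu> i = \<mu> j"
    and x: "x mod ps ! i = a i mod ps ! i" "x mod ps ! j = a j mod ps ! j" for i j x
  proof -
    have p: "ps ! i \<ge> 1" "ps ! j \<ge> 1"
      using pos ij by auto
    \<comment> \<open>Adding a common multiple of both periods keeps both residues. As the periods
      are positive, the factor \<open>a i + a j\<close> lifts the slot past the starts of both
      progressions.\<close>
    define y where "y = x + (a i + a j) * (ps ! i * ps ! j)"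
    have "(a i + a j) * 1 \<le> (a i + a j) * (ps ! i * ps ! j)"
      using p by (intro mult_le_mono) auto
    also have "\<dots> \<le> y"
      unfolding y_def by (rule le_add2)
    finally have y: "a i \<le> y" "a j \<le> y"
      by simp_all
    have "y = x + ((a i + a j) * ps ! j) * ps ! i" "y = x + ((a i + a j) * ps ! i) * ps ! j"
      unfolding y_def by (simp_all add: algebra_simps)
    then have "y mod ps ! i = a i mod ps ! i" "y mod ps ! j = a j mod ps ! j"
      using x by (metis mod_mult_self1)+
    then obtain k l where "y = a i + k * ps ! i" "y = a j + l * ps ! j"
      using y by (metis mod_eq_dvd_iff_nat dvd_def le_add_diff_inverse mult.commute)
    then show ?thesis
      using run[of i k] run[of j l] ij by simp
  qed
  then show "\<exists>\<mu> a. assignment m ps \<mu> a"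
    using \<mu> unfolding assignment_def by blast
next
  assume "\<exists>\<mu> a. assignment m ps \<mu> a"
  then obtain \<mu> a where A: "assignment m ps \<mu> a" by blast
  define P where "P i t j \<longleftrightarrow> j < length ps \<and> \<mu> j = i \<and> t mod ps ! j = a j mod ps ! j" for i t j
  have uniq: "j = j'" if "P i t j" "P i t j'" for i t j j'
    using that assignmentD[OF A] unfolding P_def by metis
  \<comment> \<open>\<open>uniq\<close> makes the definite description meaningful; slots in no class
    stay idle.\<close>
  define S where "S i t = (if \<exists>j. P i t j then Some (THE j. P i t j) else None)" for i t
  have S: "S i t = Some j \<longleftrightarrow> P i t j" for i t j
    unfolding S_def using uniq by (auto intro: the_equality theI2)
  have "exact_schedule m ps S"
    unfolding exact_schedule_def
  proof (intro allI impI)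
    fix j assume j: "j < length ps"
    have p: "ps ! j \<ge> 1"
      using pos j by auto
    have E: "executions S (\<mu> j) j = {t. t mod ps ! j = a j mod ps ! j}"
      using j unfolding executions_def S P_def by auto
    show "\<exists>i<m. (\<forall>i'<m. i' \<noteq> i \<longrightarrow> executions S i' j = {}) \<and> infinite (executions S i j) \<and>
       (\<forall>t t'. consecutive (executions S i j) t t' \<longrightarrow> t' - t = ps ! j)"
    proof (intro exI[of _ "\<mu> j"] conjI allI impI)
      show "\<mu> j < m"
        using A j unfolding assignment_def by blast
      show "executions S i' j = {}" if "i' \<noteq> \<mu> j" for i'
        using that unfolding executions_def S P_def by auto
      show "infinite (executions S (\<mu> j) j)"
        unfolding E using infinite_residue_class[OF p] .
      show "t' - t = ps ! j" if "consecutive (executions S (\<mu> j) j) t t'" for t t'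
        using that consecutive_residue_class[OF _ p] unfolding E by blast
    qed
  qed
  then show "schedulable m ps"
    unfolding schedulable_def by blast
qed

section \<open>Changing the number of machines\<close>

text \<open>A job of period 1 fills every slot of its machine, so the other jobs live on the
  remaining \<open>m\<close> machines, up to renumbering.\<close>

lemma schedulable_Suc_Cons_1:
  assumes "\<forall>p \<in> set ps. p \<ge> 1"
  shows "schedulable (Suc m) (1 # ps) \<longleftrightarrow> schedulable m ps"
proof -
  have "(\<exists>\<mu> a. assignment (Suc m) (1 # ps) \<mu> a) \<longleftrightarrow> (\<exists>\<mu> a. assignment m ps \<mu> a)"
  proof
    assume "\<exists>\<mu> a. assignment (Suc m) (1 # ps) \<mu> a"
    then obtain \<mu> a where A: "assignment (Suc m) (1 # ps) \<mu> a" by blast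
    have \<mu>: "\<mu> j < Suc m" if "j < Suc (length ps)" for j
      using A that unfolding assignment_def by simp
    \<comment> \<open>Modulo 1 all slots agree, so \<open>a (Suc j)\<close> would be a slot common
      to both jobs.\<close>
    have alone: "\<mu> (Suc j) \<noteq> \<mu> 0" if "j < length ps" for j
      using assignmentD[OF A, of "Suc j" 0 "a (Suc j)"] that by auto
    \<comment> \<open>The filler may sit on any machine. Jobs on machine \<open>m\<close> move to
      machine \<open>\<mu> 0\<close>, which holds nothing but the filler; if
      \<open>\<mu> 0 = m\<close>, then by \<open>alone\<close> no job moves.\<close>
    define \<mu>' where "\<mu>' j = (if \<mu> (Suc j) = m then \<mu> 0 else \<mu> (Suc j))" for j
    have "\<mu>' j < m" if "j < length ps" for j
      using alone[OF that] \<mu>[of 0] \<mu>[of "Suc j"] that unfolding \<mu>'_def by auto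
    moreover have "i = j" if "i < length ps" "j < length ps" "\<mu>' i = \<mu>' j"
      "x mod ps ! i = a (Suc i) mod ps ! i" "x mod ps ! j = a (Suc j) mod ps ! j" for i j x
    proof -
      have "\<mu> (Suc i) = \<mu> (Suc j)"
        using that alone unfolding \<mu>'_def by (metis (full_types))
      then show ?thesis
        using assignmentD[OF A, of "Suc i" "Suc j" x] that by simp
    qed
    ultimately have "assignment m ps \<mu>' (\<lambda>j. a (Suc j))"
      unfolding assignment_def by blast
    then show "\<exists>\<mu> a. assignment m ps \<mu> a" by blast
  next
    assume "\<exists>\<mu> a. assignment m ps \<mu> a"
    then obtain \<mu> a where A: "assignment m ps \<mu> a" by blast
    have \<mu>: "\<mu> j < m" if "j < length ps" for j
      using A that unfolding assignment_def by simp
    have "assignment (Suc m) (1 # ps) (case_nat m \<mu>) (case_nat 0 a)"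
      unfolding assignment_def
    proof (intro conjI allI impI)
      show "(case j of 0 \<Rightarrow> m | Suc x \<Rightarrow> \<mu> x) < Suc m" if "j < length (1 # ps)" for j
        using that \<mu> by (cases j) (auto intro: less_SucI)
      show "i = j" if "i < length (1 # ps)" "j < length (1 # ps)"
        "case_nat m \<mu> i = case_nat m \<mu> j"
        "x mod (1 # ps) ! i = case_nat 0 a i mod (1 # ps) ! i"
        "x mod (1 # ps) ! j = case_nat 0 a j mod (1 # ps) ! j" for i j x
        using that assignmentD[OF A, of _ _ x] \<mu>
        by (cases i; cases j) (auto dest: less_not_refl2)
    qed
    then show "\<exists>\<mu> a. assignment (Suc m) (1 # ps) \<mu> a" by blast
  qed
  then show ?thesis
    using assms by (simp add: schedulable_iff_assignment)
qed

text \<open>A residue modulo \<open>2 * p\<close> consists of a parity bit and a residue modulo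
  \<open>p\<close> of the halved number.\<close>

lemma double_mod_eq_iff:
  fixes x a p r :: nat
  assumes "r < 2"
  shows "x mod (2 * p) = (2 * a + r) mod (2 * p) \<longleftrightarrow> x mod 2 = r \<and> (x div 2) mod p = a mod p"
proof -
  have "x mod (2 * p) = 2 * (x div 2 mod p) + x mod 2"
    and "(2 * a + r) mod (2 * p) = 2 * (a mod p) + r"
    using assms by (simp_all add: mod_mult2_eq)
  moreover have "2 * c + b = 2 * d + r \<longleftrightarrow> b = r \<and> c = d" if "b < 2" for b c d :: nat
    using that assms by presburger
  ultimately show ?thesis by simp
qed

text \<open>A class with an even period lies within one parity. The even and odd slots of machine
  \<open>i\<close> thus become the slots of machines \<open>2 * i\<close> and
  \<open>2 * i + 1\<close>, where the periods are halved.\<close>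

lemma schedulable_double:
  assumes "\<forall>p \<in> set ps. p \<ge> 1"
  shows "schedulable m (map ((*) 2) ps) \<longleftrightarrow> schedulable (2 * m) ps"
proof -
  have "(\<exists>\<mu> a. assignment m (map ((*) 2) ps) \<mu> a) \<longleftrightarrow> (\<exists>\<mu> a. assignment (2 * m) ps \<mu> a)"
  proof
    assume "\<exists>\<mu> a. assignment m (map ((*) 2) ps) \<mu> a"
    then obtain \<mu> a where A: "assignment m (map ((*) 2) ps) \<mu> a" by blast
    have "assignment (2 * m) ps (\<lambda>j. 2 * \<mu> j + a j mod 2) (\<lambda>j. a j div 2)"
      unfolding assignment_def
    proof (intro conjI allI impI)
      fix j assume "j < length ps"
      then have "\<mu> j < m"
        using A unfolding assignment_def by simp
      then show "2 * \<mu> j + a j mod 2 < 2 * m" by linarith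
    next
      fix i j x
      assume ij: "i < length ps" "j < length ps"
        and eq: "2 * \<mu> i + a i mod 2 = 2 * \<mu> j + a j mod 2"
        and x: "x mod ps ! i = a i div 2 mod ps ! i" "x mod ps ! j = a j div 2 mod ps ! j"
      have "\<mu> i = \<mu> j" "a i mod 2 = a j mod 2"
        using eq by presburger+
      moreover have "(2 * x + a l mod 2) mod (2 * ps ! l) = a l mod (2 * ps ! l)"
        if "x mod ps ! l = a l div 2 mod ps ! l" for l
        using double_mod_eq_iff[of "a l mod 2" "a l" "ps ! l" x] that by simp
      \<comment> \<open>A collision in slot \<open>x\<close> of a half machine is one in slot
        \<open>2 * x + a i mod 2\<close> of the original machine.\<close>
      ultimately show "i = j"
        using assignmentD[OF A, of i j "2 * x + a i mod 2"] ij x by (metis length_map nth_map)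
    qed
    then show "\<exists>\<mu> a. assignment (2 * m) ps \<mu> a" by blast
  next
    assume "\<exists>\<mu> a. assignment (2 * m) ps \<mu> a"
    then obtain \<mu> a where A: "assignment (2 * m) ps \<mu> a" by blast
    have "assignment m (map ((*) 2) ps) (\<lambda>j. \<mu> j div 2) (\<lambda>j. 2 * a j + \<mu> j mod 2)"
      unfolding assignment_def
    proof (intro conjI allI impI)
      fix j assume "j < length (map ((*) 2) ps)"
      then have "\<mu> j < 2 * m"
        using A unfolding assignment_def by simp
      then show "\<mu> j div 2 < m" by linarith
    next
      fix i j x
      assume ij: "i < length (map ((*) 2) ps)" "j < length (map ((*) 2) ps)"
        and eq: "\<mu> i div 2 = \<mu> j div 2"
        and x: "x mod map ((*) 2) ps ! i = (2 * a i + \<mu> i mod 2) mod map ((*) 2) ps ! i"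
          "x mod map ((*) 2) ps ! j = (2 * a j + \<mu> j mod 2) mod map ((*) 2) ps ! j"
      then have "x mod 2 = \<mu> i mod 2" "x div 2 mod ps ! i = a i mod ps ! i"
        "x mod 2 = \<mu> j mod 2" "x div 2 mod ps ! j = a j mod ps ! j"
        by (simp_all add: double_mod_eq_iff)
      moreover from this eq have "\<mu> i = \<mu> j"
        by (metis div_mult_mod_eq)
      ultimately show "i = j"
        using assignmentD[OF A, of i j "x div 2"] ij by simp
    qed
    then show "\<exists>\<mu> a. assignment m (map ((*) 2) ps) \<mu> a" by blast
  qed
  then show ?thesis
    using assms by (simp add: schedulable_iff_assignment)
qed

text \<open>The recursion follows \<open>binary\<close>, so that each zero digit yields one filler job; the reduction
  can emit them while it reads the digits.\<close>

fun fillers :: "nat \<Rightarrow> nat list" where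
  "fillers n =
     (if n = 0 then [] else fillers (n div 2) @ (if even n then [2 ^ length (binary n)] else []))"

declare fillers.simps [simp del]

lemma length_binary: "n > 0 \<Longrightarrow> length (binary n) = Suc (length (binary (n div 2)))"
  by (simp add: binary.simps[of n])

text \<open>Counting machines as \<open>Suc m\<close> aligns the rounds with the digits of
  \<open>m\<close>: for odd \<open>m\<close>, \<open>Suc m\<close> is already
  \<open>2 * Suc (m div 2)\<close>; for even \<open>m\<close> it becomes so after adding one filler.
  Each round thus strips one digit, and \<open>m = 0\<close> is the single machine.\<close>

lemma schedulable_Suc_iff_fillers:
  assumes "\<forall>p \<in> set qs. p \<ge> 1"
  shows "schedulable (Suc m) qs \<longleftrightarrow>
    schedulable 1 (fillers m @ map ((*) (2 ^ length (binary m))) qs)"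
  using assms
proof (induction m arbitrary: qs rule: less_induct)
  case (less m)
  show ?case
  proof (cases "m = 0")
    case True
    then show ?thesis
      by (simp add: binary.simps[of 0] fillers.simps[of 0])
  next
    case False
    define k where "k = length (binary (m div 2))"
    have k: "length (binary m) = Suc k"
      using False by (simp add: k_def length_binary)
    define rs where "rs = (if even m then 1 # qs else qs)"
    have rs: "\<forall>p \<in> set rs. p \<ge> 1"
      using less.prems by (auto simp: rs_def)
    have "schedulable (Suc m) qs \<longleftrightarrow> schedulable (2 * Suc (m div 2)) rs"
    proof (cases "even m")
      case True
      then show ?thesis
        using schedulable_Suc_Cons_1[OF less.prems, of "Suc m"] by (simp add: rs_def)
    next
      case odd: False
      then have "2 * Suc (m div 2) = Suc m"
        by presburger
      with odd show ?thesis
        by (simp add: rs_def)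
    qed
    also have "\<dots> \<longleftrightarrow> schedulable (Suc (m div 2)) (map ((*) 2) rs)"
      using schedulable_double[OF rs] by simp
    also have "\<dots> \<longleftrightarrow> schedulable 1 (fillers (m div 2) @ map ((*) (2 ^ k)) (map ((*) 2) rs))"
      unfolding k_def using False rs by (intro less.IH) auto
    \<comment> \<open>The filler 1 at the head of \<open>rs\<close> is scaled to
      \<open>2 ^ Suc k\<close>, which is the last entry of \<open>fillers m\<close>.\<close>
    also have "fillers (m div 2) @ map ((*) (2 ^ k)) (map ((*) 2) rs) =
        fillers m @ map ((*) (2 ^ length (binary m))) qs"
      using False by (simp add: fillers.simps[of m] rs_def k mult_ac)
    finally show ?thesis .
  qed
qed

text \<open>The additional period 1 pays for the passage from \<open>m\<close> to
  \<open>Suc m\<close> machines.\<close>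

lemma schedulable_iff_single:
  assumes "\<forall>p \<in> set ps. p \<ge> 1"
  shows "schedulable m ps \<longleftrightarrow>
    schedulable 1 (fillers m @ map ((*) (2 ^ length (binary m))) (1 # ps))"
  using assms schedulable_Suc_Cons_1[OF assms] schedulable_Suc_iff_fillers[of "1 # ps" m]
  by simp

section \<open>The reduction on words\<close>

text \<open>\<open>k\<close> is the number of digits of the machine count. \<open>red_start\<close> expects the first digit of
  a period, \<open>red_bits\<close> a later one; malformed input is rejected by a trailing \<open>Zero\<close>.\<close>

fun red_bits :: "nat \<Rightarrow> letter list \<Rightarrow> letter list" and
    red_start :: "nat \<Rightarrow> letter list \<Rightarrow> letter list" where
  "red_bits k [] = [Zero]"
| "red_bits k (Zero # w) = Zero # red_bits k w"
| "red_bits k (One # w) = One # red_bits k w"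
| "red_bits k (Sep # w) = replicate k Zero @ Sep # red_start k w"
| "red_start k [] = []"
| "red_start k (One # w) = One # red_bits k w"
| "red_start k (Zero # w) = [Zero]"
| "red_start k (Sep # w) = [Zero]"

text \<open>After \<open>k\<close> digits a zero is digit \<open>k + 1\<close> and yields the filler
  \<open>2 ^ Suc k\<close>. The separator yields \<open>2 ^ k\<close>, the scaled period 1 that
  turns \<open>m\<close> machines into \<open>Suc m\<close>.\<close>

fun red_machines :: "nat \<Rightarrow> letter list \<Rightarrow> letter list" where
  "red_machines k [] = [Zero]"
| "red_machines k (One # w) = red_machines (Suc k) w"
| "red_machines k (Zero # w) =
     One # replicate (Suc k) Zero @ Sep # red_machines (Suc k) w"
| "red_machines k (Sep # w) = One # replicate k Zero @ Sep # red_start k w"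

text \<open>The test of the first letter excludes a zero machine count and leading zeros, which
  \<open>red_machines\<close> would accept.\<close>

definition reduction :: "letter list \<Rightarrow> letter list" where
  "reduction w = (if w \<noteq> [] \<and> hd w = One then red_machines 0 w else [Zero])"

section \<open>Binary numerals and correctness on encodings\<close>

lemma encode_simps [simp]:
  "encode [] = []" "encode (n # ns) = binary n @ Sep # encode ns"
  "encode (ms @ ns) = encode ms @ encode ns"
  by (simp_all add: encode_def)

lemma binary_double: "n > 0 \<Longrightarrow> binary (2 * n) = binary n @ [Zero]"
  by (simp add: binary.simps[of "2 * n"])

lemma binary_double_Suc: "binary (Suc (2 * n)) = binary n @ [One]"
  by (simp add: binary.simps[of "Suc (2 * n)"])

lemma binary_power2_mult: "n > 0 \<Longrightarrow> binary (2 ^ k * n) = binary n @ replicate k Zero"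
  by (induction k) (simp_all add: binary_double mult.assoc replicate_append_same)

lemma binary_power2: "binary (2 ^ k) = One # replicate k Zero"
  using binary_power2_mult[of 1 k] binary_double_Suc[of 0] by (simp add: binary.simps[of 0])

lemma binary_pos: "n > 0 \<Longrightarrow> \<exists>bs. binary n = One # bs \<and> Sep \<notin> set bs"
proof (induction n rule: less_induct)
  case (less n)
  show ?case
  proof (cases "n div 2 = 0")
    case True
    then have "n = 1"
      using less.prems by linarith
    then show ?thesis
      using binary_power2[of 0] by simp
  next
    case False
    then obtain bs where "binary (n div 2) = One # bs" "Sep \<notin> set bs"
      using less.IH[of "n div 2"] less.prems by auto
    then show ?thesis
      using less.prems by (simp add: binary.simps[of n])
  qed
qed

text \<open>Appending a digit doubles the number, plus one for \<open>One\<close>. This recovers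
  numbers from words that the reduction does not reject.\<close>

lemma binary_surj: "Sep \<notin> set bs \<Longrightarrow> \<exists>n > 0. One # bs = binary n"
proof (induction bs rule: rev_induct)
  case Nil
  then show ?case
    using binary_power2[of 0] by (intro exI[of _ 1]) auto
next
  case (snoc b bs)
  then obtain n where n: "n > 0" "One # bs = binary n" by auto
  show ?case
  proof (cases b)
    case Zero
    then show ?thesis
      using n by (intro exI[of _ "2 * n"]) (auto simp: binary_double)
  next
    case One
    then show ?thesis
      using n by (intro exI[of _ "Suc (2 * n)"]) (auto simp: binary_double_Suc)
  qed (use snoc.prems in auto)
qed

lemma red_bits_append:
  "Sep \<notin> set bs \<Longrightarrow> red_bits k (bs @ w) = bs @ red_bits k w"
proof (induction bs)
  case (Cons b bs)
  then show ?case by (cases b) auto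
qed simp

lemma red_start_encode:
  "\<forall>p \<in> set ps. p \<ge> 1 \<Longrightarrow> red_start k (encode ps) = encode (map ((*) (2 ^ k)) ps)"
proof (induction ps)
  case (Cons p ps)
  then obtain bs where "binary p = One # bs" "Sep \<notin> set bs"
    using binary_pos[of p] by auto
  with Cons show ?case
    by (simp add: red_bits_append binary_power2_mult)
qed simp

text \<open>\<open>binary\<close> grows at its right end while \<open>red_machines\<close> reads
  from the left, so the rest \<open>w\<close> is kept general: the induction hypothesis is used with
  the last digit put in front of \<open>w\<close>.\<close>

lemma red_machines_binary:
  "red_machines 0 (binary n @ w) = encode (fillers n) @ red_machines (length (binary n)) w"
proof (induction n arbitrary: w rule: less_induct)
  case (less n)
  show ?case
  proof (cases "n = 0")
    case False
    then show ?thesis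
      using less.IH[of "n div 2"] binary_power2[of "length (binary n)"]
      by (simp add: binary.simps[of n] fillers.simps[of n])
  qed (simp add: binary.simps[of 0] fillers.simps[of 0])
qed

lemma reduction_encode:
  assumes "m \<ge> 1" "\<forall>p \<in> set ps. p \<ge> 1"
  shows "reduction (encode (m # ps)) =
    encode (fillers m @ map ((*) (2 ^ length (binary m))) (1 # ps))"
proof -
  obtain bs where "binary m = One # bs"
    using binary_pos[of m] assms by auto
  then have "reduction (encode (m # ps)) = red_machines 0 (binary m @ Sep # encode ps)"
    by (simp add: reduction_def)
  then show ?thesis
    using assms by (simp add: red_machines_binary binary_power2 red_start_encode)
qed

text \<open>Encodings are terminated in this sense, whereas the result of a rejection is not.\<close>

definition terminated :: "letter list \<Rightarrow> bool" where
  "terminated w \<longleftrightarrow> w = [] \<or> last w = Sep"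

lemma terminated_Cons_append [simp]: "terminated (x # u @ Sep # v) \<longleftrightarrow> terminated v"
  by (auto simp: terminated_def)

lemma not_terminated_Zero [simp]: "\<not> terminated (u @ [Zero])" "\<not> terminated [Zero]"
  "\<not> terminated (x # u @ [Zero])"
  by (auto simp: terminated_def)

lemma terminated_encode: "terminated (encode ns)"
  by (induction ns) (auto simp: terminated_def)

lemma Sep_split: "(\<exists>bs v. w = bs @ Sep # v \<and> Sep \<notin> set bs) \<or> Sep \<notin> set w"
  by (metis split_list_first)

text \<open>Each round consumes one period up to its separator, hence induction on length. If no
  separator is left, \<open>red_bits\<close> ends in \<open>Zero\<close>.\<close>

lemma terminated_red_start:
  "terminated (red_start k w) \<Longrightarrow> \<exists>ps. w = encode ps \<and> (\<forall>p \<in> set ps. p \<ge> 1)"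
proof (induction w rule: length_induct)
  case (1 w)
  show ?case
  proof (cases w)
    case Nil
    then show ?thesis by (intro exI[of _ "[]"]) simp
  next
    case (Cons x w')
    then have x: "x = One"
      using 1 by (cases x) auto
    consider bs v where "w' = bs @ Sep # v" "Sep \<notin> set bs" | "Sep \<notin> set w'"
      using Sep_split by blast
    then show ?thesis
    proof cases
      case 1
      then have "terminated (red_start k v)"
        using "1.prems" Cons x by (simp add: red_bits_append terminated_def split: if_splits)
      moreover have "length v < length w"
        using 1 Cons by simp
      ultimately obtain ps where ps: "v = encode ps" "\<forall>p \<in> set ps. p \<ge> 1"
        using "1.IH" by blast
      obtain n where "n > 0" "One # bs = binary n"
        using binary_surj 1 by blast
      then show ?thesis
        using ps Cons x 1 by (intro exI[of _ "n # ps"]) auto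
    next
      case 2
      then show ?thesis
        using "1.prems" Cons x red_bits_append[of w' k "[]"] by simp
    qed
  qed
qed

lemma terminated_red_machines:
  "terminated (red_machines k w) \<Longrightarrow>
    \<exists>bs ps. w = bs @ Sep # encode ps \<and> Sep \<notin> set bs \<and> (\<forall>p \<in> set ps. p \<ge> 1)"
proof (induction w arbitrary: k)
  case (Cons x w)
  show ?case
  proof (cases "x = Sep")
    case True
    then have "terminated (red_start k w)"
      using Cons.prems by simp
    then show ?thesis
      using True terminated_red_start[of k w] by (metis append_Nil empty_iff list.set(1))
  next
    case False
    then have "terminated (red_machines (Suc k) w)"
      using Cons.prems terminated_Cons_append[of One "replicate (Suc k) Zero"]
      by (cases x) simp_all
    then obtain bs ps where "w = bs @ Sep # encode ps" "Sep \<notin> set bs" "\<forall>p \<in> set ps. p \<ge> 1"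
      using Cons.IH by blast
    with False show ?thesis
      by (intro exI[of _ "x # bs"] exI[of _ ps]) auto
  qed
qed simp

lemma terminated_reduction:
  assumes "terminated (reduction w)"
  shows "\<exists>m ps. w = encode (m # ps) \<and> m \<ge> 1 \<and> (\<forall>p \<in> set ps. p \<ge> 1)"
proof -
  obtain w' where w: "w = One # w'" "terminated (red_machines (Suc 0) w')"
    using assms by (cases w) (auto simp: reduction_def split: if_splits)
  then obtain bs ps where bs: "w' = bs @ Sep # encode ps" "Sep \<notin> set bs" "\<forall>p \<in> set ps. p \<ge> 1"
    using terminated_red_machines by blast
  then obtain m where "m > 0" "One # bs = binary m"
    using binary_surj by blast
  then show ?thesis
    using w bs by (intro exI[of _ m] exI[of _ ps]) auto
qed

lemma fillers_pos: "p \<in> set (fillers n) \<Longrightarrow> p \<ge> 1"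
proof (induction n rule: less_induct)
  case (less n)
  show ?case
  proof (cases "n = 0")
    case False
    then show ?thesis
      using less.IH[of "n div 2"] less.prems
      by (auto simp: fillers.simps[of n] split: if_splits)
  qed (use less.prems in \<open>simp add: fillers.simps[of 0]\<close>)
qed

text \<open>On encodings the claim is the scheduling equivalence. Any other word is mapped to one
  that is not terminated and hence encodes no list.\<close>

lemma reduction_correct: "w \<in> WSP_multi \<longleftrightarrow> reduction w \<in> WSP_single"
proof -
  have "w \<in> WSP_multi \<longleftrightarrow> (\<exists>m ps. w = encode (m # ps) \<and> m \<ge> 1 \<and> (\<forall>p \<in> set ps. p \<ge> 1) \<and>
    reduction w \<in> WSP_single)"
    (is "_ \<longleftrightarrow> ?R")
  proof -
    have "reduction (encode (m # ps)) \<in> WSP_single \<longleftrightarrow> schedulable m ps"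
      if "m \<ge> 1" "\<forall>p \<in> set ps. p \<ge> 1" for m ps
      using that fillers_pos[of _ m]
      by (auto simp: WSP_single_def reduction_encode[OF that] schedulable_iff_single[OF that(2)]
          inj_eq[OF inj_encode] simp del: encode_simps list.map)
    then show ?thesis
      unfolding WSP_multi_def by (auto simp del: encode_simps)
  qed
  moreover have "terminated (reduction w)" if "reduction w \<in> WSP_single"
    using that terminated_encode unfolding WSP_single_def by auto
  ultimately show ?thesis
    using terminated_reduction by blast
qed

section \<open>The Turing machine\<close>

text \<open>The middle tape holds the number \<open>k\<close> of digits of the machine count read so far, in unary. The
  result lists the new state, the input move, the counter symbol and move, and the letter appended
  to the output, if any. States 2 and 3 (likewise 4 and 5) rewind the counter and append \<open>k\<close> zeros
  and a separator.\<close>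

definition reject :: "letter option \<Rightarrow> nat \<times> move \<times> letter option \<times> move \<times> letter option" where
  "reject c = (8, Stay, c, Stay, Some Zero)"

definition rewind ::
    "nat \<Rightarrow> letter option \<Rightarrow> nat \<times> move \<times> letter option \<times> move \<times> letter option" where
  "rewind q c = (if c = None then (Suc q, Stay, c, MoveRight, None) else (q, Stay, c, MoveLeft, None))"

definition fill ::
    "nat \<Rightarrow> nat \<Rightarrow> letter option \<Rightarrow> nat \<times> move \<times> letter option \<times> move \<times> letter option" where
  "fill q r c =
     (if c = None then (r, Stay, c, Stay, Some Sep) else (q, Stay, c, MoveRight, Some Zero))"

text \<open>States 1, 6 and 7 carry out \<open>red_machines\<close>, \<open>red_start\<close> and
  \<open>red_bits\<close>; state 0 makes the initial test of \<open>reduction\<close> without moving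
  the input head. States 2 and 3 lead back to 1, states 4 and 5 to 6.\<close>

definition red_trans ::
    "nat \<Rightarrow> letter option \<Rightarrow> letter option \<Rightarrow> nat \<times> move \<times> letter option \<times> move \<times> letter option" where
  "red_trans q x c =
     (if q = 0 then (if x = Some One then (1, Stay, c, Stay, None) else reject c)
      else if q = 1 then
        (case x of
           None \<Rightarrow> reject c
         | Some One \<Rightarrow> (1, MoveRight, Some Zero, MoveRight, None)
         | Some Zero \<Rightarrow> (2, MoveRight, Some Zero, Stay, Some One)
         | Some Sep \<Rightarrow> (4, MoveRight, c, MoveLeft, Some One))
      else if q = 2 then rewind 2 c
      else if q = 3 then fill 3 1 c
      else if q = 4 then rewind 4 c
      else if q = 5 then fill 5 6 c
      else if q = 6 then
        (if x = None then (8, Stay, c, Stay, None)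
         else if x = Some One then (7, MoveRight, c, Stay, Some One)
         else reject c)
      else
        (case x of
           None \<Rightarrow> reject c
         | Some Sep \<Rightarrow> (4, MoveRight, c, MoveLeft, None)
         | Some b \<Rightarrow> (7, MoveRight, c, Stay, Some b)))"

definition red_tm :: "letter tm" where
  "red_tm = \<lparr>num_tapes = 3, num_states = 9, start = 0, halt = 8,
     trans = (\<lambda>q syms. case red_trans q (syms ! 0) (syms ! 1) of (q', d, c, e, y) \<Rightarrow>
       (q', [(syms ! 0, d), (c, e), (y, if y = None then Stay else MoveRight)]))\<rparr>"

section \<open>Configurations and single steps\<close>

lemma wf_red_tm: "wf_tm red_tm"
proof -
  have "fst (red_trans q x c) < 9" for q x c
    by (auto simp: red_trans_def reject_def rewind_def fill_def split: option.split letter.split)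
  then show ?thesis
    by (auto simp: wf_tm_def red_tm_def split: prod.split) (metis fst_conv)
qed

text \<open>\<open>u\<close> is the input already read and \<open>w\<close> the rest. The counter
  head \<open>h\<close> is an integer because rewinding ends on the blank cell -1.\<close>

definition conf :: "nat \<Rightarrow> letter list \<Rightarrow> letter list \<Rightarrow> int \<Rightarrow> nat \<Rightarrow> letter list \<Rightarrow> nat \<times> letter tape list"
  where "conf q u w h k out =
    (q, [(word_on_tape (u @ w), int (length u)), (word_on_tape (replicate k Zero), h),
      (word_on_tape out, int (length out))])"

lemma word_on_tape_append_at:
  "word_on_tape (u @ w) (int (length u)) = (if w = [] then None else Some (hd w))"
  by (cases w) (auto simp: word_on_tape_def)

lemma word_on_tape_replicate:
  "word_on_tape (replicate k x) h = (if 0 \<le> h \<and> h < int k then Some x else None)"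
  by (auto simp: word_on_tape_def)

lemma word_on_tape_snoc:
  "(word_on_tape out)(int (length out) := Some y) = word_on_tape (out @ [y])"
  by (rule ext) (auto simp: word_on_tape_def nth_append)

lemma word_on_tape_replicate_Suc:
  "(word_on_tape (replicate k x))(int k := Some x) = word_on_tape (replicate (Suc k) x)"
  using word_on_tape_snoc[of "replicate k x" x] by (simp add: replicate_append_same)

lemma word_on_tape_end: "word_on_tape out (int (length out)) = None"
  by (simp add: word_on_tape_def)

definition displace :: "move \<Rightarrow> int" where
  "displace d = (case d of MoveLeft \<Rightarrow> - 1 | Stay \<Rightarrow> 0 | MoveRight \<Rightarrow> 1)"

lemma displace_simps [simp]:
  "displace MoveLeft = - 1" "displace Stay = 0" "displace MoveRight = 1"
  by (simp_all add: displace_def)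

text \<open>The last assumption lists the only actions that occur: the input head stays or advances
  within \<open>w\<close>, and the counter is kept or extended at its end. Under them configurations
  of the form \<open>conf\<close> are closed.\<close>

lemma step_conf:
  fixes h :: int and k :: nat and w :: "letter list"
  defines "x \<equiv> if w = [] then None else Some (hd w)"
    and "z \<equiv> if 0 \<le> h \<and> h < int k then Some Zero else None"
  assumes "q \<noteq> 8"
    and "case red_trans q x z of (q', d, c, e, y) \<Rightarrow>
      (d = Stay \<or> d = MoveRight \<and> w \<noteq> []) \<and> (c = z \<or> c = Some Zero \<and> h = int k)"
  shows "step red_tm (conf q u w h k out) =
    (case red_trans q x z of (q', d, c, e, y) \<Rightarrow>
      conf q' (if d = Stay then u else u @ [hd w]) (if d = Stay then w else tl w) (h + displace e)
        (if c = z then k else Suc k) (out @ (case y of None \<Rightarrow> [] | Some b \<Rightarrow> [b])))"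
proof -
  obtain q' d c e y where t: "red_trans q x z = (q', d, c, e, y)"
    using prod_cases5 by blast
  have d: "d = Stay \<or> d = MoveRight \<and> w \<noteq> []" and c: "c = z \<or> c = Some Zero \<and> h = int k"
    using assms(4) t by auto
  have x: "word_on_tape (u @ w) (int (length u)) = x"
    unfolding x_def by (rule word_on_tape_append_at)
  have z: "word_on_tape (replicate k Zero) h = z"
    unfolding z_def by (rule word_on_tape_replicate)
  have "(word_on_tape (u @ w))(int (length u) := x) = word_on_tape (u @ w)"
    using fun_upd_triv[of "word_on_tape (u @ w)" "int (length u)"] x by simp
  then have A: "act_tape (x, d) (word_on_tape (u @ w), int (length u)) =
      (word_on_tape ((if d = Stay then u else u @ [hd w]) @ (if d = Stay then w else tl w)),
       int (length (if d = Stay then u else u @ [hd w])))"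
    using d by auto
  have "(word_on_tape (replicate k Zero))(h := c) =
      word_on_tape (replicate (if c = z then k else Suc k) Zero)"
  proof (cases "c = z")
    case True
    then show ?thesis
      using fun_upd_triv[of "word_on_tape (replicate k Zero)" h] z by simp
  next
    case False
    then show ?thesis
      using c word_on_tape_replicate_Suc[of k Zero] by simp
  qed
  then have B: "act_tape (c, e) (word_on_tape (replicate k Zero), h) =
      (word_on_tape (replicate (if c = z then k else Suc k) Zero), h + displace e)"
    by (simp add: displace_def split: move.split)
  have C: "act_tape (y, if y = None then Stay else MoveRight) (word_on_tape out, int (length out)) =
     (word_on_tape (out @ (case y of None \<Rightarrow> [] | Some b \<Rightarrow> [b])),
      int (length (out @ (case y of None \<Rightarrow> [] | Some b \<Rightarrow> [b]))))"
    using word_on_tape_end[of out] fun_upd_triv[of "word_on_tape out" "int (length out)"]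
    by (cases y) (simp_all add: word_on_tape_snoc)
  show ?thesis
    using assms(3) t A B C by (simp add: conf_def red_tm_def x z del: act_tape.simps)
qed

lemmas step_red_tm = step_conf red_trans_def reject_def rewind_def fill_def

section \<open>Runs with a bound on the number of steps\<close>

definition reaches :: "nat \<Rightarrow> nat \<times> letter tape list \<Rightarrow> nat \<times> letter tape list \<Rightarrow> bool" where
  "reaches t c d \<longleftrightarrow> (\<exists>s \<le> t. (step red_tm ^^ s) c = d)"

lemma reaches_refl: "reaches t c c"
  unfolding reaches_def by (intro exI[of _ 0]) simp_all

lemma reaches_trans:
  assumes "reaches s c d" "reaches t d e"
  shows "reaches (s + t) c e"
proof -
  obtain i j where "i \<le> s" "(step red_tm ^^ i) c = d" "j \<le> t" "(step red_tm ^^ j) d = e"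
    using assms unfolding reaches_def by blast
  then show ?thesis
    unfolding reaches_def by (intro exI[of _ "j + i"]) (simp add: funpow_add)
qed

lemma reaches_step:
  assumes "step red_tm c = d" "reaches t d e"
  shows "reaches (Suc t) c e"
proof -
  have "reaches 1 c d"
    using assms(1) unfolding reaches_def by (intro exI[of _ 1]) simp
  from reaches_trans[OF this assms(2)] show ?thesis by simp
qed

lemma reaches_mono: "reaches s c d \<Longrightarrow> s \<le> t \<Longrightarrow> reaches t c d"
  unfolding reaches_def using order_trans by blast

text \<open>The halting state is a fixed point of \<open>step\<close>, so an upper bound on the time
  becomes the exact step count that \<open>computes_in_time\<close> asks for.\<close>

lemma reaches_halted:
  assumes "reaches t c (8, tps)"
  shows "(step red_tm ^^ t) c = (8, tps)"
proof -
  obtain s where s: "s \<le> t" "(step red_tm ^^ s) c = (8, tps)"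
    using assms unfolding reaches_def by blast
  have "(step red_tm ^^ n) (8, tps) = (8, tps)" for n
  proof (induction n)
    case (Suc n)
    then show ?case by (simp add: red_tm_def)
  qed simp
  then show ?thesis
    using s funpow_add[of "t - s" s "step red_tm"] by simp
qed

text \<open>There are \<open>j\<close> moves to the left down to cell -1, and one step to notice the
  blank there and return to cell 0.\<close>

lemma rewind_reaches:
  assumes "j \<le> k" "q = 2 \<or> q = 4"
  shows "reaches (Suc j) (conf q u w (int j - 1) k out) (conf (Suc q) u w 0 k out)"
  using assms(1)
proof (induction j)
  case 0
  have "step red_tm (conf q u w (int 0 - 1) k out) = conf (Suc q) u w 0 k out"
    using assms(2) by (auto simp: step_red_tm add.commute)
  then show ?case
    by (rule reaches_step) (rule reaches_refl)
next
  case (Suc j)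
  then have "step red_tm (conf q u w (int (Suc j) - 1) k out) = conf q u w (int j - 1) k out"
    using assms(2) by (auto simp: step_red_tm add.commute)
  then show ?case
    using Suc by (auto intro: reaches_step)
qed

text \<open>Here \<open>i\<close> counter cells remain to be copied; the blank after them triggers
  the separator and leaves the head at the end of the counter.\<close>

lemma fill_reaches:
  assumes "(q, r) \<in> {(3, 1), (5, 6)}"
  shows "reaches (Suc i) (conf q u w (int j) (j + i) out)
    (conf r u w (int (j + i)) (j + i) (out @ replicate i Zero @ [Sep]))"
proof (induction i arbitrary: j out)
  case 0
  have "step red_tm (conf q u w (int j) (j + 0) out) = conf r u w (int j) (j + 0) (out @ [Sep])"
    using assms by (auto simp: step_red_tm add.commute)
  then show ?case
    by (auto intro: reaches_step reaches_refl)
next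
  case (Suc i)
  have "step red_tm (conf q u w (int j) (j + Suc i) out) =
      conf q u w (int (Suc j)) (Suc j + i) (out @ [Zero])"
    using assms by (auto simp: step_red_tm add.commute)
  then show ?case
    using Suc[of "Suc j" "out @ [Zero]"] by (auto intro: reaches_step)
qed

lemma append_zeros_reaches:
  assumes "(q, r) \<in> {(2, 1), (4, 6)}"
  shows "reaches (2 * k + 2) (conf q u w (int k - 1) k out)
    (conf r u w (int k) k (out @ replicate k Zero @ [Sep]))"
proof -
  have "reaches (Suc k + Suc k) (conf q u w (int k - 1) k out)
    (conf r u w (int k) k (out @ replicate k Zero @ [Sep]))"
    using assms rewind_reaches[of k k q u w out] fill_reaches[of "Suc q" r k u w 0 out]
    by (intro reaches_trans) auto
  then show ?thesis by (rule reaches_mono) simp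
qed

section \<open>The machine computes the reduction\<close>

definition outputs :: "nat \<Rightarrow> nat \<times> letter tape list \<Rightarrow> letter list \<Rightarrow> bool" where
  "outputs t c v \<longleftrightarrow> (\<exists>tps. reaches t c (8, tps) \<and> fst (last tps) = word_on_tape v)"

lemma outputs_step: "step red_tm c = d \<Longrightarrow> outputs t d v \<Longrightarrow> outputs (Suc t) c v"
  unfolding outputs_def using reaches_step by blast

lemma outputs_mono: "outputs s c v \<Longrightarrow> s \<le> t \<Longrightarrow> outputs t c v"
  unfolding outputs_def using reaches_mono by blast

lemma outputs_halt:
  assumes "step red_tm c = conf 8 u w h k out" "1 \<le> t"
  shows "outputs t c out"
proof -
  have "outputs 0 (conf 8 u w h k out) out"
    unfolding outputs_def conf_def using reaches_refl by fastforce
  from outputs_step[OF assms(1) this] assms(2) show ?thesis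
    by (auto elim: outputs_mono)
qed

lemma outputs_trans: "reaches s c d \<Longrightarrow> outputs t d v \<Longrightarrow> outputs (s + t) c v"
  unfolding outputs_def using reaches_trans by blast

text \<open>A separator is the most expensive letter: one step to read it and
  \<open>2 * k + 2\<close> to append the zeros. The extra step is for halting.\<close>

lemma outputs_red_start:
  "outputs (Suc (length w * (2 * k + 3))) (conf 7 u w (int k) k out) (out @ red_bits k w)"
  "outputs (Suc (length w * (2 * k + 3))) (conf 6 u w (int k) k out) (out @ red_start k w)"
proof (induction k w and k w arbitrary: u out and u out rule: red_bits_red_start.induct)
  case (1 k)
  have "step red_tm (conf 7 u [] (int k) k out) = conf 8 u [] (int k) k (out @ [Zero])"
    by (simp add: step_red_tm)
  from outputs_halt[OF this] show ?case by simp
next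
  case (2 k w)
  have "step red_tm (conf 7 u (Zero # w) (int k) k out) =
      conf 7 (u @ [Zero]) w (int k) k (out @ [Zero])"
    by (auto simp: step_red_tm add.commute)
  from outputs_step[OF this 2] show ?case
    by (auto elim: outputs_mono)
next
  case (3 k w)
  have "step red_tm (conf 7 u (One # w) (int k) k out) =
      conf 7 (u @ [One]) w (int k) k (out @ [One])"
    by (auto simp: step_red_tm add.commute)
  from outputs_step[OF this 3] show ?case
    by (auto elim: outputs_mono)
next
  case (4 k w)
  have "step red_tm (conf 7 u (Sep # w) (int k) k out) =
      conf 4 (u @ [Sep]) w (int k - 1) k out"
    by (auto simp: step_red_tm add.commute)
  from outputs_step[OF this outputs_trans[OF append_zeros_reaches 4]] show ?case
    by (auto elim: outputs_mono)
next
  case (5 k)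
  have "step red_tm (conf 6 u [] (int k) k out) = conf 8 u [] (int k) k (out @ [])"
    by (simp add: step_red_tm)
  from outputs_halt[OF this] show ?case by simp
next
  case (6 k w)
  have "step red_tm (conf 6 u (One # w) (int k) k out) =
      conf 7 (u @ [One]) w (int k) k (out @ [One])"
    by (auto simp: step_red_tm add.commute)
  from outputs_step[OF this 6] show ?case
    by (auto elim: outputs_mono)
next
  case (7 k w)
  have "step red_tm (conf 6 u (Zero # w) (int k) k out) = conf 8 u (Zero # w) (int k) k (out @ [Zero])"
    by (simp add: step_red_tm)
  from outputs_halt[OF this] show ?case by simp
next
  case (8 k w)
  have "step red_tm (conf 6 u (Sep # w) (int k) k out) = conf 8 u (Sep # w) (int k) k (out @ [Zero])"
    by (simp add: step_red_tm)
  from outputs_halt[OF this] show ?case by simp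
qed

text \<open>The counter grows during the run, and \<open>n\<close> bounds its final length, so a
  uniform budget per letter suffices. A \<open>Zero\<close> costs \<open>1 + (2 * Suc k + 2)\<close>
  steps, within \<open>2 * n + 3\<close> because \<open>Suc k \<le> n\<close>.\<close>

lemma outputs_red_machines:
  "k + length w \<le> n \<Longrightarrow>
    outputs (Suc (length w * (2 * n + 3))) (conf 1 u w (int k) k out) (out @ red_machines k w)"
proof (induction k w arbitrary: u out rule: red_machines.induct)
  case (1 k)
  have "step red_tm (conf 1 u [] (int k) k out) = conf 8 u [] (int k) k (out @ [Zero])"
    by (simp add: step_red_tm)
  from outputs_halt[OF this] show ?case by simp
next
  case (2 k w)
  have s: "step red_tm (conf 1 u (One # w) (int k) k out) =
      conf 1 (u @ [One]) w (int (Suc k)) (Suc k) out"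
    by (auto simp: step_red_tm add.commute)
  from outputs_step[OF s 2(1)] 2(2) show ?case
    by (auto elim: outputs_mono)
next
  case (3 k w)
  \<comment> \<open>The new mark is written on cell \<open>k\<close> and the head stays there, that
    is, on the last cell of the extended counter, where rewinding starts.\<close>
  have s: "step red_tm (conf 1 u (Zero # w) (int k) k out) =
      conf 2 (u @ [Zero]) w (int (Suc k) - 1) (Suc k) (out @ [One])"
    by (auto simp: step_red_tm add.commute)
  have ih: "outputs (Suc (length w * (2 * n + 3))) (conf 1 u' w (int (Suc k)) (Suc k) out')
      (out' @ red_machines (Suc k) w)" for u' out'
    by (rule 3(1)) (use 3(2) in simp)
  have "outputs (Suc (2 * Suc k + 2 + Suc (length w * (2 * n + 3))))
      (conf 1 u (Zero # w) (int k) k out)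
      (((out @ [One]) @ replicate (Suc k) Zero @ [Sep]) @ red_machines (Suc k) w)"
    by (rule outputs_step[OF s outputs_trans[OF append_zeros_reaches ih]]) simp
  then show ?case
    using 3(2) by (auto elim: outputs_mono)
next
  case (4 k w)
  have s: "step red_tm (conf 1 u (Sep # w) (int k) k out) =
      conf 4 (u @ [Sep]) w (int k - 1) k (out @ [One])"
    by (auto simp: step_red_tm add.commute)
  have rest: "outputs (Suc (length w * (2 * n + 3))) (conf 6 u' w (int k) k out')
      (out' @ red_start k w)" for u' out'
    by (rule outputs_mono[OF outputs_red_start(2)]) (use 4 in simp)
  have "outputs (Suc (2 * k + 2 + Suc (length w * (2 * n + 3))))
      (conf 1 u (Sep # w) (int k) k out)
      (((out @ [One]) @ replicate k Zero @ [Sep]) @ red_start k w)"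
    by (rule outputs_step[OF s outputs_trans[OF append_zeros_reaches rest]]) simp
  then show ?case
    using 4 by (auto elim: outputs_mono)
qed

lemma initial_config_red_tm: "initial_config red_tm w = conf 0 [] w 0 0 []"
proof -
  have "word_on_tape ([] :: letter list) = (\<lambda>_. None)"
    by (auto simp: word_on_tape_def)
  then show ?thesis
    by (simp add: initial_config_def conf_def red_tm_def numeral_2_eq_2)
qed

text \<open>The constant 2 covers the initial test in state 0 and the halting step.\<close>

lemma outputs_reduction:
  "outputs (2 + length w * (2 * length w + 3)) (initial_config red_tm w) (reduction w)"
proof (cases "w \<noteq> [] \<and> hd w = One")
  case True
  then have "step red_tm (conf 0 [] w 0 0 []) = conf 1 [] w (int 0) 0 []"
    by (auto simp: step_red_tm add.commute)
  from outputs_step[OF this outputs_red_machines[of 0 w "length w"]] True show ?thesis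
    by (auto simp: initial_config_red_tm reduction_def)
next
  case False
  have "step red_tm (conf 0 [] w 0 0 []) = conf 8 [] w 0 0 [Zero]"
    using False by (auto simp: step_red_tm add.commute)
  from outputs_halt[OF this] False show ?thesis
    by (auto simp: initial_config_red_tm reduction_def)
qed

lemma poly_time_computable_reduction: "poly_time_computable reduction"
  unfolding poly_time_computable_def
proof (intro exI conjI)
  show "wf_tm red_tm" by (fact wf_red_tm)
  have halt: "halt red_tm = 8"
    by (simp add: red_tm_def)
  show "computes_in_time red_tm reduction (poly [:2, 3, 2:])"
    unfolding computes_in_time_def
  proof (intro allI)
    fix w :: "letter list"
    have "poly [:2, 3, 2:] (length w) = 2 + length w * (2 * length w + 3)"
      by (simp add: algebra_simps)
    then obtain tps where
      "reaches (poly [:2, 3, 2:] (length w)) (initial_config red_tm w) (8, tps)"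
      "fst (last tps) = word_on_tape (reduction w)"
      using outputs_reduction[of w] unfolding outputs_def by metis
    then show
      "case (step red_tm ^^ poly [:2, 3, 2:] (length w)) (initial_config red_tm w) of
        (q, tps) \<Rightarrow> q = halt red_tm \<and> fst (last tps) = word_on_tape (reduction w)"
      by (simp add: reaches_halted halt del: poly_pCons)
  qed
qed

theorem theorem5: "WSP_multi \<le>\<^sub>p WSP_single"
  unfolding poly_time_reducible_def
  using poly_time_computable_reduction reduction_correct by blast

end
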